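(* Suppose Assumptions 1 and 2 (stated in the context) hold, let $\lambda>G/\rho$, $p=\frac{\lambda\rho}{\lambda\rho-G}$ and $\bar G=G+\lambda G_c$. Let $\epsilon>0$ be the target accuracy for which Assumption 2(iii) is assumed, and in the algorithm LoPGD (described in the context) let $$\eta_1=\frac{\epsilon_0}{2p\bar G^2},\qquad K=\lceil\log_2(\epsilon_0/\epsilon)\rceil,\qquad t=\left\lceil\frac{4\sigma^2p^2\bar G^2}{\epsilon^{2(1-\theta)}}\right\rceil,$$ where $K\ge 1$ and $\theta,\sigma$ are the constants appearing in the local error bound condition, Assumption 2(iii). Then the output $\mathbf{x}_K$ satisfies $$f(\mathbf{x}_K)-f_*\le 2\epsilon .$$
   Context: The problem is $\min_{\mathbf{x}\in\mathbb{R}^d} f(\mathbf{x})$ subject to $c(\mathbf{x})\le 0$, with $f$ convex and $c$ lower-semicontinuous and convex; $\Omega_*$ is its set of optimal solutions and $f_*$ its optimal value. $\Omega=\{\mathbf{x}:c(\mathbf{x})\le 0\}$; $\|\cdot\|$ is the Euclidean norm; $\mathrm{dist}(\mathbf{x},S)=\min_{\mathbf{u}\in S}\|\mathbf{x}-\mathbf{u}\|$; $\Pi_\Omega[\mathbf{x}]=\arg\min_{\mathbf{u}\in\Omega}\|\mathbf{u}-\mathbf{x}\|^2$; $[s]_+=\max(s,0)$; $\mathcal{S}_\epsilon=\{\mathbf{x}\in\Omega:f(\mathbf{x})\le f_*+\epsilon\}$. Assumption 1: (i) there exists $\rho>0$ such that $\min\{\|\mathbf{v}\|: c(\mathbf{x})=0,\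 \mathbf{v}\in\partial c(\mathbf{x}),\ \mathbf{v}\ne 0\}\ge\rho$, or, more generally, there exists $\rho>0$ such that for every $\mathbf{x}\in\mathbb{R}^d$ the point $\mathbf{x}^\natural=\Pi_\Omega[\mathbf{x}]$ satisfies $\|\mathbf{x}^\natural-\mathbf{x}\|\le [c(\mathbf{x})]_+/\rho$ (the first condition implies the second with the same $\rho$); (ii) there exists $\mathbf{x}$ with $c(\mathbf{x})<0$; (iii) $f$ and $c$ are defined everywhere on $\mathbb{R}^d$ and are Lipschitz continuous with Lipschitz constants $G$ and $G_c$, respectively. Assumption 2: (i) there exist $\mathbf{x}_0\in\Omega$ and $\epsilon_0\ge 0$ with $f(\mathbf{x}_0)-\min_{\mathbf{x}\in\Omega}f(\mathbf{x})\le\epsilon_0$; (ii) $\Omega_*$ is a non-empty convex compact set; (iii) (local error bound) there exist $\theta\in(0,1]$ and $\sigma>0$ such that $\mathrm{dist}(\mathbf{x},\Omega_* )\le\sigma(f(\mathbf{x})-f_* )^\theta$ for every $\mathbf{x}\in\mathcal{S}_\epsilon$. Algorithm LoPGD. Let $F(\mathbf{x})=f(\mathbf{x})+\lambda[c(\mathbf{x})]_+$. Input $K,t\in\mathbb{N}^+$ and $\eta_1$; initialize with $\mathbf{x}_0,\epsilon_0$ of Assumption 2(i). For $k=1,\dots,K$: set $\mathbf{x}^k_1=\mathbf{x}_{k-1}$; for $s=1,\dots,t-1$ set $\mathbf{x}^k_{s+1}=\mathbf{x}^k_s-\eta_k\,\partial F(\mathbf{x}^k_s)$ (with $\partial F(\mathbf{x}^k_s)$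 any subgradient of $F$ at $\mathbf{x}^k_s$); set $\widehat{\mathbf{x}}_k=\frac1t\sum_{s=1}^t\mathbf{x}^k_s$, $\mathbf{x}_k=\Pi_\Omega[\widehat{\mathbf{x}}_k]$ and $\eta_{k+1}=\eta_k/2$. The output is $\mathbf{x}_K$; one projection is performed per epoch $k$. *)

theory Defs
  imports "HOL-Analysis.Analysis"
begin

definition lower_semicontinuous :: "('a::topological_space \<Rightarrow> real) \<Rightarrow> bool" where
  "lower_semicontinuous g \<longleftrightarrow> (\<forall>a. open {x. a < g x})"

definition subdifferential :: "('a::real_inner \<Rightarrow> real) \<Rightarrow> 'a \<Rightarrow> 'a set" where
  "subdifferential g x = {v. \<forall>y. g x + v \<bullet> (y - x) \<le> g y}"

definition feasible_set :: "('a \<Rightarrow> real) \<Rightarrow> 'a set" where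
  "feasible_set c = {x. c x \<le> 0}"

definition opt_value :: "('a \<Rightarrow> real) \<Rightarrow> ('a \<Rightarrow> real) \<Rightarrow> real" where
  "opt_value f c = (INF x\<in>feasible_set c. f x)"

definition opt_set :: "('a \<Rightarrow> real) \<Rightarrow> ('a \<Rightarrow> real) \<Rightarrow> 'a set" where
  "opt_set f c = {x \<in> feasible_set c. \<forall>y\<in>feasible_set c. f x \<le> f y}"

definition sublevel_set :: "('a \<Rightarrow> real) \<Rightarrow> ('a \<Rightarrow> real) \<Rightarrow> real \<Rightarrow> 'a set" where
  "sublevel_set f c \<epsilon> = {x \<in> feasible_set c. f x \<le> opt_value f c + \<epsilon>}"

(* The minimum of the norms over an empty set of subgradients is read as +infinity. *)
definition subgradient_lower_bound :: "('a::real_inner \<Rightarrow> real) \<Rightarrow> real \<Rightarrow> bool" where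
  "subgradient_lower_bound c \<rho> \<longleftrightarrow>
     (\<forall>x v. c x = 0 \<and> v \<in> subdifferential c x \<and> v \<noteq> 0 \<longrightarrow> \<rho> \<le> norm v)"

definition projection_error_bound :: "('a::euclidean_space \<Rightarrow> real) \<Rightarrow> real \<Rightarrow> bool" where
  "projection_error_bound c \<rho> \<longleftrightarrow>
     (\<forall>x. norm (closest_point (feasible_set c) x - x) \<le> max (c x) 0 / \<rho>)"

definition local_error_bound ::
    "('a::metric_space \<Rightarrow> real) \<Rightarrow> ('a \<Rightarrow> real) \<Rightarrow> real \<Rightarrow> real \<Rightarrow> real \<Rightarrow> bool" where
  "local_error_bound f c \<epsilon> \<theta> \<sigma> \<longleftrightarrow>
     (\<forall>x\<in>sublevel_set f c \<epsilon>. infdist x (opt_set f c) \<le> \<sigma> * (f x - opt_value f c) powr \<theta>)"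

definition penalized ::
    "('a \<Rightarrow> real) \<Rightarrow> ('a \<Rightarrow> real) \<Rightarrow> real \<Rightarrow> 'a \<Rightarrow> real" where
  "penalized f c lam x = f x + lam * max (c x) 0"

(* Subgradients may be chosen arbitrarily, so the algorithm is a predicate on complete runs:
   eta k is the step size of epoch k, z k s the inner iterate x^k_s, xhat k the average and
   xs k the projected iterate x_k. The output of the run is xs K. *)
definition LoPGD_run ::
    "('a::euclidean_space \<Rightarrow> real) \<Rightarrow> ('a \<Rightarrow> real) \<Rightarrow> real \<Rightarrow> nat \<Rightarrow> nat \<Rightarrow> real \<Rightarrow> 'a \<Rightarrow>
     (nat \<Rightarrow> real) \<Rightarrow> (nat \<Rightarrow> nat \<Rightarrow> 'a) \<Rightarrow> (nat \<Rightarrow> 'a) \<Rightarrow> (nat \<Rightarrow> 'a) \<Rightarrow> bool" where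
  "LoPGD_run f c lam K t \<eta>\<^sub>1 x\<^sub>0 eta z xhat xs \<longleftrightarrow>
     xs 0 = x\<^sub>0 \<and> eta 1 = \<eta>\<^sub>1 \<and>
     (\<forall>k\<in>{1..K}.
        z k 1 = xs (k - 1) \<and>
        (\<forall>s\<in>{1..<t}. \<exists>g\<in>subdifferential (penalized f c lam) (z k s).
            z k (s + 1) = z k s - eta k *\<^sub>R g) \<and>
        xhat k = (1 / real t) *\<^sub>R (\<Sum>s=1..t. z k s) \<and>
        xs k = closest_point (feasible_set c) (xhat k) \<and>
        eta (k + 1) = eta k / 2)"

end

theory Submission
  imports Defs
begin

text \<open>
  Each epoch is analysed against the point \<open>u\<close> of the \<open>\<epsilon>\<close>-sublevel set nearest to \<open>x\<^sub>k\<^sub>-\<^sub>1\<close>.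
  A convex combination of \<open>x\<^sub>k\<^sub>-\<^sub>1\<close> and an optimal point lies in the sublevel set, so the obtuse
  angle property of the projection turns the error bound at \<open>u\<close> into
  \<open>\<parallel>x\<^sub>k\<^sub>-\<^sub>1 - u\<parallel> \<le> \<sigma> \<epsilon>\<^bsup>\<theta>-1\<^esup> \<epsilon>\<^sub>k\<^sub>-\<^sub>1\<close>, where \<open>\<epsilon>\<^sub>k = \<epsilon>\<^sub>0 / 2\<^bsup>k\<^esup>\<close>. The standard estimate for the
  averaged subgradient method then gives \<open>F(\<xi>) - F(u) \<le> \<epsilon>\<^sub>k\<close> for the average \<open>\<xi>\<close>, and
  since \<open>\<lambda>\<rho> \<ge> G\<close> the penalty pays for the final projection: \<open>f(x\<^sub>k) \<le> F(\<xi>)\<close>. Hence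
  \<open>f(x\<^sub>k) - f\<^sub>* \<le> \<epsilon>\<^sub>k + \<epsilon>\<close> for all \<open>k\<close>.
\<close>

section \<open>Closedness, convexity and the optimal value\<close>

lemma feasible_set_closed:
  assumes "continuous_on UNIV c"
  shows "closed (feasible_set c)"
  unfolding feasible_set_def using assms by (intro closed_Collect_le) auto

lemma convex_sublevel:
  assumes "convex_on UNIV g"
  shows "convex {x. g x \<le> (a::real)}"
proof (rule convexI)
  fix x y u v
  assume "x \<in> {x. g x \<le> a}" "y \<in> {x. g x \<le> a}" "(0::real) \<le> u" "(0::real) \<le> v" "u + v = 1"
  then show "u *\<^sub>R x + v *\<^sub>R y \<in> {x. g x \<le> a}"
    using convex_lower[OF assms, of x y u v] by simp
qed

lemma convex_feasible_set:
  assumes "convex_on UNIV c"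
  shows "convex (feasible_set c)"
  unfolding feasible_set_def by (rule convex_sublevel[OF assms])

lemma opt_value_eq:
  assumes "x \<in> opt_set f c"
  shows "opt_value f c = f x"
  unfolding opt_value_def
  using assms by (intro cInf_eq_minimum) (auto simp: opt_set_def)

lemma opt_value_le:
  assumes "opt_set f c \<noteq> {}" and "x \<in> feasible_set c"
  shows "opt_value f c \<le> f x"
proof -
  obtain y where y: "y \<in> opt_set f c" using assms(1) by blast
  show ?thesis using opt_value_eq[OF y] y assms(2) by (auto simp: opt_set_def)
qed

subsection \<open>From the subgradient bound to the projection error bound\<close>

text \<open>A Lagrange multiplier built by hand. The half-space with outward normal \<open>v\<close>
  at \<open>q\<close> contains the feasible set. Since \<open>c\<close> is nonnegative on the
  bounding hyperplane, convexity separates the quotients of \<open>c\<close> by the signed height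
  \<open>v \<bullet> (y - q)\<close> below the hyperplane from those above it. Any number in between
  is a slope that minorizes \<open>c\<close>, and the Slater point makes it positive.\<close>

lemma subgradient_along_separating_normal:
  fixes c :: "'a::real_inner \<Rightarrow> real"
  assumes conv: "convex_on UNIV c" and cont: "continuous_on UNIV c"
    and q: "c q \<le> 0" and v: "v \<noteq> 0"
    and sep: "\<And>y. c y \<le> 0 \<Longrightarrow> v \<bullet> (y - q) \<le> 0"
    and slater: "c y\<^sub>0 < 0"
  obtains \<mu> where "\<mu> > 0" and "\<mu> *\<^sub>R v \<in> subdifferential c q" and "c q = 0"
proof -
  \<comment> \<open>A negative value on the hyperplane would survive a small move along
    \<open>v\<close>, by continuity, and give a feasible point outside the half-space.\<close>
  have hyp: "0 \<le> c y" if y: "v \<bullet> (y - q) = 0" for y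
  proof (rule ccontr)
    assume "\<not> 0 \<le> c y"
    then have "c y < 0" by simp
    moreover have "((\<lambda>h. c (y + h *\<^sub>R v)) \<longlongrightarrow> c (y + 0 *\<^sub>R v)) (at_right 0)"
      using cont by (intro isCont_tendsto_compose[of _ c] tendsto_intros)
        (simp add: continuous_on_eq_continuous_at)
    ultimately have "\<forall>\<^sub>F h in at_right 0. c (y + h *\<^sub>R v) < 0"
      by (intro order_tendstoD(2)) auto
    moreover have "\<forall>\<^sub>F h in at_right 0. (0::real) < h"
      by (simp add: eventually_at_right_less)
    ultimately have "\<forall>\<^sub>F h in at_right (0::real). c (y + h *\<^sub>R v) < 0 \<and> 0 < h"
      by eventually_elim simp
    then obtain h :: real where h: "c (y + h *\<^sub>R v) < 0" "0 < h"
      using eventually_happens'[OF trivial_limit_at_right_real] by blast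
    have "v \<bullet> (y + h *\<^sub>R v - q) = h * (v \<bullet> v)"
      using y by (simp add: inner_diff_right inner_add_right)
    moreover have "h * (v \<bullet> v) > 0" using h v by simp
    ultimately show False using sep[of "y + h *\<^sub>R v"] h by simp
  qed
  have cq: "c q = 0" using hyp[of q] q by simp
  define s where "s y = v \<bullet> (y - q)" for y
  have slope: "c b / s b \<le> c a / s a" if a: "s a > 0" and b: "s b < 0" for a b
  proof -
    \<comment> \<open>The weight that places the convex combination of \<open>b\<close> and
      \<open>a\<close> on the hyperplane, where \<open>hyp\<close> applies.\<close>
    define \<tau> where "\<tau> = - s b / (s a - s b)"
    have \<tau>: "0 \<le> \<tau>" "\<tau> \<le> 1" "1 - \<tau> = s a / (s a - s b)"
      using a b by (auto simp: \<tau>_def field_simps)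
    have "v \<bullet> ((1 - \<tau>) *\<^sub>R b + \<tau> *\<^sub>R a - q) = (1 - \<tau>) * s b + \<tau> * s a"
      unfolding s_def by (simp add: inner_diff_right inner_add_right algebra_simps)
    also have "\<dots> = 0" unfolding \<tau>(3) using a b by (simp add: \<tau>_def field_simps)
    finally have "0 \<le> c ((1 - \<tau>) *\<^sub>R b + \<tau> *\<^sub>R a)" by (rule hyp)
    also have "\<dots> \<le> (1 - \<tau>) * c b + \<tau> * c a"
      using \<tau> by (intro convex_onD[OF conv]) auto
    also have "\<dots> = (s a * c b - s b * c a) / (s a - s b)"
      unfolding \<tau>(3) by (simp add: \<tau>_def diff_divide_distrib)
    finally have "0 \<le> s a * c b - s b * c a"
      using a b by (simp add: zero_le_divide_iff)
    then show ?thesis using a b by (simp add: field_simps)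
  qed
  have sy0: "s y\<^sub>0 < 0"
    using sep[of y\<^sub>0] hyp[of y\<^sub>0] slater unfolding s_def by fastforce
  \<comment> \<open>\<open>Inf A\<close> is the multiplier. The quotient at the Slater point bounds
    \<open>A\<close> from below and is itself positive.\<close>
  define A where "A = (\<lambda>a. c a / s a) ` {a. s a > 0}"
  have "s (q + v) > 0" using v by (simp add: s_def)
  then have ne: "A \<noteq> {}" by (auto simp: A_def)
  have lower: "c b / s b \<le> Inf A" if "s b < 0" for b
    using slope that by (intro cInf_greatest[OF ne]) (auto simp: A_def)
  have upper: "Inf A \<le> c a / s a" if "s a > 0" for a
    using slope[OF _ sy0] that
    by (intro cInf_lower bdd_belowI[of _ "c y\<^sub>0 / s y\<^sub>0"]) (auto simp: A_def)
  have "0 < c y\<^sub>0 / s y\<^sub>0" using slater sy0 by (simp add: divide_neg_neg)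
  with lower[OF sy0] have pos: "0 < Inf A" by simp
  have "Inf A * s y \<le> c y" for y
  proof -
    consider "s y > 0" | "s y < 0" | "s y = 0" by linarith
    then show ?thesis
    proof cases
      case 1
      with upper[OF 1] show ?thesis by (simp add: field_simps)
    next
      case 2
      with lower[OF 2] show ?thesis by (simp add: field_simps)
    next
      case 3
      with hyp[of y] show ?thesis by (simp add: s_def)
    qed
  qed
  then have "Inf A *\<^sub>R v \<in> subdifferential c q"
    by (simp add: subdifferential_def cq s_def)
  with pos cq that show thesis by blast
qed

text \<open>At the projection \<open>q\<close> of an infeasible \<open>x\<close> the vector
  \<open>x - q\<close> is a separating normal, so some positive multiple of it is a subgradient, of
  norm at least \<open>\<rho>\<close>. Being parallel to \<open>x - q\<close>, it has inner product
  with \<open>x - q\<close> equal to the product of the norms, and the subgradient inequality at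
  \<open>x\<close> yields the bound.\<close>

lemma projection_error_bound_if_subgradient_lower_bound:
  fixes c :: "'a::euclidean_space \<Rightarrow> real"
  assumes conv: "convex_on UNIV c" and cont: "continuous_on UNIV c"
    and slater: "c y\<^sub>0 < 0" and "\<rho> > 0" and bound: "subgradient_lower_bound c \<rho>"
  shows "projection_error_bound c \<rho>"
  unfolding projection_error_bound_def
proof
  fix x
  let ?S = "feasible_set c"
  define q where "q = closest_point ?S x"
  have S: "closed ?S" "convex ?S" "?S \<noteq> {}"
    using feasible_set_closed[OF cont] convex_feasible_set[OF conv] slater
    by (auto simp: feasible_set_def intro: less_imp_le)
  have q: "c q \<le> 0"
    using closest_point_in_set[OF S(1,3), of x] by (simp add: q_def feasible_set_def)
  show "norm (closest_point ?S x - x) \<le> max (c x) 0 / \<rho>"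
  proof (cases "x = q")
    case True
    then show ?thesis using \<open>\<rho> > 0\<close> True[unfolded q_def, symmetric] by simp
  next
    case False
    have sep: "(x - q) \<bullet> (y - q) \<le> 0" if "c y \<le> 0" for y
      unfolding q_def using that
      by (intro closest_point_dot[OF S(2,1)]) (simp add: feasible_set_def)
    obtain \<mu> where \<mu>: "\<mu> > 0" "\<mu> *\<^sub>R (x - q) \<in> subdifferential c q" "c q = 0"
      using subgradient_along_separating_normal[OF conv cont q _ sep slater] False by auto
    have "\<rho> \<le> norm (\<mu> *\<^sub>R (x - q))"
      using bound \<mu> False unfolding subgradient_lower_bound_def by fastforce
    then have "\<rho> * norm (x - q) \<le> norm (\<mu> *\<^sub>R (x - q)) * norm (x - q)"
      by (intro mult_right_mono) auto
    also have "\<dots> = (\<mu> *\<^sub>R (x - q)) \<bullet> (x - q)"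
      using \<mu>(1) by (simp add: dot_square_norm power2_eq_square)
    also have "\<dots> \<le> c x"
      using \<mu>(2) unfolding subdifferential_def by (auto simp: \<mu>(3) dest: spec[of _ x])
    also have "\<dots> \<le> max (c x) 0" by simp
    finally show ?thesis
      using \<open>\<rho> > 0\<close> by (simp add: q_def[symmetric] norm_minus_commute field_simps)
  qed
qed

subsection \<open>The averaged subgradient method\<close>

text \<open>Test the subgradient inequality one step along the subgradient itself, at
  \<open>x + g\<close>.\<close>

lemma norm_subgradient_le:
  fixes F :: "'a::real_inner \<Rightarrow> real"
  assumes lip: "L-lipschitz_on UNIV F" and g: "g \<in> subdifferential F x"
  shows "norm g \<le> L"
proof (cases "g = 0")
  case True
  then show ?thesis using lipschitz_on_nonneg[OF lip] by simp
next
  case False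
  have "norm g * norm g = g \<bullet> ((x + g) - x)" by (simp add: dot_square_norm power2_eq_square)
  also have "\<dots> \<le> F (x + g) - F x"
    using g by (auto simp: subdifferential_def dest: spec[of _ "x + g"])
  also have "\<dots> \<le> dist (F (x + g)) (F x)" by (simp add: dist_real_def)
  also have "\<dots> \<le> L * norm g"
    using lipschitz_onD[OF lip, of "x + g" x] by (simp add: dist_norm)
  finally show ?thesis using False by simp
qed

text \<open>Squared distances to \<open>u\<close> telescope, and Jensen's inequality passes to the
  average. The point \<open>u\<close> is arbitrary, so each epoch may choose its own. The average
  has \<open>t\<close> points although only \<open>t - 1\<close> steps are made.\<close>

lemma averaged_subgradient_method:
  fixes F :: "'a::real_inner \<Rightarrow> real" and z :: "nat \<Rightarrow> 'a"
  assumes conv: "convex_on UNIV F" and lip: "L-lipschitz_on UNIV F"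
    and \<eta>: "\<eta> > 0" and t: "t \<ge> 1"
    and step: "\<And>s. s \<in> {1..<t} \<Longrightarrow>
      \<exists>g\<in>subdifferential F (z s). z (s + 1) = z s - \<eta> *\<^sub>R g"
  shows "F ((1 / real t) *\<^sub>R (\<Sum>s=1..t. z s)) - F u
    \<le> (norm (z 1 - u))\<^sup>2 / (2 * \<eta> * real t) + \<eta> * L\<^sup>2 / 2"
proof -
  have descent: "2 * \<eta> * (F (z s) - F u) \<le> (norm (z s - u))\<^sup>2 - (norm (z (s + 1) - u))\<^sup>2 + \<eta>\<^sup>2 * L\<^sup>2"
    if s: "s \<in> {1..<t}" for s
  proof -
    obtain g where g: "g \<in> subdifferential F (z s)" "z (s + 1) = z s - \<eta> *\<^sub>R g"
      using step[OF s] by blast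
    have next_eq: "z (s + 1) - u = (z s - u) - \<eta> *\<^sub>R g"
      unfolding g(2) by (simp add: algebra_simps)
    have eq: "(norm (z (s + 1) - u))\<^sup>2
        = (norm (z s - u))\<^sup>2 - 2 * \<eta> * (g \<bullet> (z s - u)) + \<eta>\<^sup>2 * (norm g)\<^sup>2"
      unfolding next_eq power2_norm_eq_inner inner_diff_left[of "z s - u"] inner_diff_right[of _ "z s - u"]
      by (simp add: inner_commute[of "z s - u" g] power2_eq_square)
    have "F (z s) - F u \<le> g \<bullet> (z s - u)"
      using g(1) unfolding subdifferential_def by (auto simp: inner_diff_right dest: spec[of _ u])
    then have "2 * \<eta> * (F (z s) - F u) \<le> 2 * \<eta> * (g \<bullet> (z s - u))"
      using \<eta> by (intro mult_left_mono) auto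
    moreover have "\<eta>\<^sup>2 * (norm g)\<^sup>2 \<le> \<eta>\<^sup>2 * L\<^sup>2"
      using norm_subgradient_le[OF lip g(1)] by (intro mult_left_mono power_mono) auto
    ultimately show ?thesis unfolding eq by linarith
  qed
  \<comment> \<open>The final squared distance is kept on the left, because it cancels against the
    estimate for the last iterate.\<close>
  have "(\<Sum>s=1..n. 2 * \<eta> * (F (z s) - F u)) + (norm (z (n + 1) - u))\<^sup>2
      \<le> (norm (z 1 - u))\<^sup>2 + real n * (\<eta>\<^sup>2 * L\<^sup>2)" if "n < t" for n
    using that
  proof (induction n)
    case (Suc n)
    then show ?case using descent[of "Suc n"] by (simp add: algebra_simps)
  qed simp
  from this[of "t - 1"] have partial: "(\<Sum>s=1..t-1. 2 * \<eta> * (F (z s) - F u)) + (norm (z t - u))\<^sup>2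
      \<le> (norm (z 1 - u))\<^sup>2 + real (t - 1) * (\<eta>\<^sup>2 * L\<^sup>2)" using t by simp
  \<comment> \<open>No step leaves the last iterate, so no subgradient is given there; the Lipschitz bound and
    AM-GM replace the descent inequality.\<close>
  have "2 * \<eta> * (F (z t) - F u) \<le> 2 * \<eta> * (L * norm (z t - u))"
    using lipschitz_onD[OF lip, of "z t" u] \<eta>
    by (intro mult_left_mono) (auto simp: dist_norm)
  also have "\<dots> \<le> (norm (z t - u))\<^sup>2 + \<eta>\<^sup>2 * L\<^sup>2"
    using sum_squares_bound[of "norm (z t - u)" "\<eta> * L"]
    by (simp add: power_mult_distrib algebra_simps)
  finally have last: "2 * \<eta> * (F (z t) - F u) \<le> \<dots>" .
  have "(\<Sum>s=1..t. 2 * \<eta> * (F (z s) - F u))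
      = (\<Sum>s=1..t-1. 2 * \<eta> * (F (z s) - F u)) + 2 * \<eta> * (F (z t) - F u)"
    using t by (cases t) auto
  also have "\<dots> \<le> (norm (z 1 - u))\<^sup>2 + real t * (\<eta>\<^sup>2 * L\<^sup>2)"
    using partial last t by (simp add: of_nat_diff algebra_simps)
  finally have sum: "2 * \<eta> * (\<Sum>s=1..t. F (z s) - F u)
      \<le> (norm (z 1 - u))\<^sup>2 + real t * (\<eta>\<^sup>2 * L\<^sup>2)" by (simp add: sum_distrib_left)
  have "F ((1 / real t) *\<^sub>R (\<Sum>s=1..t. z s)) = F (\<Sum>s=1..t. (1 / real t) *\<^sub>R z s)"
    by (simp add: scaleR_sum_right)
  also have "\<dots> \<le> (\<Sum>s=1..t. (1 / real t) * F (z s))"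
    using t by (intro convex_on_sum[OF _ _ conv]) auto
  also have "\<dots> - F u = (\<Sum>s=1..t. F (z s) - F u) / real t"
    using t by (simp add: sum_subtractf sum_divide_distrib[symmetric] field_simps)
  finally have "F ((1 / real t) *\<^sub>R (\<Sum>s=1..t. z s)) - F u \<le> (\<Sum>s=1..t. F (z s) - F u) / real t"
    by simp
  also have "\<dots> = 2 * \<eta> * (\<Sum>s=1..t. F (z s) - F u) / (2 * \<eta> * real t)"
    using \<eta> t by simp
  also have "\<dots> \<le> ((norm (z 1 - u))\<^sup>2 + real t * (\<eta>\<^sup>2 * L\<^sup>2)) / (2 * \<eta> * real t)"
    using sum \<eta> by (intro divide_right_mono) auto
  also have "\<dots> = (norm (z 1 - u))\<^sup>2 / (2 * \<eta> * real t) + \<eta> * L\<^sup>2 / 2"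
    using \<eta> t by (simp add: field_simps power2_eq_square)
  finally show ?thesis .
qed

subsection \<open>The penalized objective\<close>

lemma convex_on_penalized:
  assumes "convex_on UNIV f" and "convex_on UNIV c" and "lam \<ge> 0"
  shows "convex_on UNIV (penalized f c lam)"
proof -
  have "convex_on UNIV (\<lambda>x. max (c x) 0)"
  proof (rule convex_onI)
    fix u :: real and x y
    assume u: "0 < u" "u < 1"
    have "c ((1 - u) *\<^sub>R x + u *\<^sub>R y) \<le> (1 - u) * c x + u * c y"
      using u by (intro convex_onD[OF assms(2)]) auto
    also have "\<dots> \<le> (1 - u) * max (c x) 0 + u * max (c y) 0"
      using u by (intro add_mono mult_left_mono) auto
    finally show "max (c ((1 - u) *\<^sub>R x + u *\<^sub>R y)) 0 \<le> (1 - u) * max (c x) 0 + u * max (c y) 0"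
      using u by simp
  qed simp
  then show ?thesis
    unfolding penalized_def using assms
    by (intro convex_on_add convex_on_cmul) auto
qed

lemma lipschitz_on_penalized:
  assumes f: "G-lipschitz_on UNIV f" and c: "G\<^sub>c-lipschitz_on UNIV c" and lam: "lam \<ge> 0"
  shows "(G + lam * G\<^sub>c)-lipschitz_on UNIV (penalized f c lam)"
proof (rule lipschitz_onI)
  show "0 \<le> G + lam * G\<^sub>c"
    using lipschitz_on_nonneg[OF f] lipschitz_on_nonneg[OF c] lam by simp
  fix x y
  have "\<bar>max (c x) 0 - max (c y) 0\<bar> \<le> \<bar>c x - c y\<bar>" by linarith
  also have "\<dots> \<le> G\<^sub>c * dist x y"
    using lipschitz_onD[OF c, of x y] by (simp add: dist_real_def)
  finally have "lam * \<bar>max (c x) 0 - max (c y) 0\<bar> \<le> lam * (G\<^sub>c * dist x y)"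
    using lam by (rule mult_left_mono)
  moreover have "\<bar>f x - f y\<bar> \<le> G * dist x y"
    using lipschitz_onD[OF f, of x y] by (simp add: dist_real_def)
  moreover have "\<bar>penalized f c lam x - penalized f c lam y\<bar>
      \<le> \<bar>f x - f y\<bar> + lam * \<bar>max (c x) 0 - max (c y) 0\<bar>"
    using abs_triangle_ineq[of "f x - f y" "lam * (max (c x) 0 - max (c y) 0)"] lam
    by (simp add: penalized_def abs_mult right_diff_distrib[symmetric] add_diff_add)
  ultimately show "dist (penalized f c lam x) (penalized f c lam y) \<le> (G + lam * G\<^sub>c) * dist x y"
    by (simp add: dist_real_def algebra_simps)
qed

text \<open>Exact penalization: projecting raises \<open>f\<close> by at most \<open>G\<close> times
  the distance moved, and the error bound makes that distance at most the constraint violation over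
  \<open>\<rho>\<close>.\<close>

lemma objective_at_projection_le_penalized:
  fixes c :: "'a::euclidean_space \<Rightarrow> real"
  assumes f: "G-lipschitz_on UNIV f" and peb: "projection_error_bound c \<rho>"
    and \<rho>: "\<rho> > 0" and lam: "lam * \<rho> \<ge> G"
  shows "f (closest_point (feasible_set c) x) \<le> penalized f c lam x"
proof -
  let ?q = "closest_point (feasible_set c) x"
  have d: "norm (?q - x) * \<rho> \<le> max (c x) 0"
    using peb \<rho> unfolding projection_error_bound_def by (simp add: pos_le_divide_eq)
  have lam0: "0 \<le> lam"
    using lam \<rho> lipschitz_on_nonneg[OF f] by (smt (verit) mult_neg_pos)
  have "f ?q - f x \<le> G * norm (?q - x)"
    using lipschitz_onD[OF f, of ?q x] by (simp add: dist_norm)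
  also have "\<dots> \<le> lam * \<rho> * norm (?q - x)"
    using lam by (intro mult_right_mono) auto
  also have "\<dots> = lam * (norm (?q - x) * \<rho>)" by simp
  also have "\<dots> \<le> lam * max (c x) 0"
    using d lam0 by (rule mult_left_mono)
  finally show ?thesis by (simp add: penalized_def)
qed

subsection \<open>Distance to the sublevel set\<close>

text \<open>Here \<open>\<delta>\<close> bounds the excess of \<open>x\<close> over the level
  \<open>\<epsilon>\<close>. The error bound is invoked only at \<open>u\<close>, which lies in the
  sublevel set, and convexity transfers it to \<open>x\<close>: the ratio of
  \<open>norm (x - u)\<close> to the distance from \<open>u\<close> to an optimal point is at most
  \<open>\<delta> / \<epsilon>\<close>.\<close>

lemma distance_to_sublevel_set:
  fixes f c :: "'a::euclidean_space \<Rightarrow> real"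
  assumes f: "convex_on UNIV f" "continuous_on UNIV f"
    and c: "convex_on UNIV c" "continuous_on UNIV c"
    and opt: "opt_set f c \<noteq> {}" "compact (opt_set f c)"
    and \<epsilon>: "\<epsilon> > 0" and \<theta>: "\<theta> \<ge> 0" and \<sigma>: "\<sigma> \<ge> 0"
    and leb: "local_error_bound f c \<epsilon> \<theta> \<sigma>"
    and x: "x \<in> feasible_set c" "f x - opt_value f c \<le> \<epsilon> + \<delta>" and \<delta>: "\<delta> \<ge> 0"
  obtains u where "u \<in> sublevel_set f c \<epsilon>" and "norm (x - u) \<le> \<sigma> * \<epsilon> powr (\<theta> - 1) * \<delta>"
proof (cases "f x - opt_value f c \<le> \<epsilon>")
  case True
  then have "x \<in> sublevel_set f c \<epsilon>" using x by (simp add: sublevel_set_def)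
  then show thesis using that[of x] \<sigma> \<delta> by simp
next
  case False
  let ?S = "sublevel_set f c \<epsilon>" and ?m = "opt_value f c"
  have S_eq: "?S = feasible_set c \<inter> {x. f x \<le> ?m + \<epsilon>}"
    by (auto simp: sublevel_set_def)
  have "closed {x. f x \<le> ?m + \<epsilon>}"
    using f(2) by (intro closed_Collect_le) auto
  then have S: "closed ?S" "convex ?S"
    unfolding S_eq using feasible_set_closed[OF c(2)] convex_feasible_set[OF c(1)]
      convex_sublevel[OF f(1)] by (auto intro: convex_Int)
  have "opt_set f c \<subseteq> ?S"
    using opt_value_eq[of _ f c] \<epsilon> by (fastforce simp: sublevel_set_def opt_set_def)
  then have ne: "?S \<noteq> {}" using opt(1) by blast
  define u where "u = closest_point ?S x"
  have u: "u \<in> ?S" unfolding u_def by (rule closest_point_in_set[OF S(1) ne])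
  obtain w where w: "w \<in> opt_set f c" "infdist u (opt_set f c) = dist u w"
    using infdist_attains_inf[OF compact_imp_closed[OF opt(2)] opt(1)] by blast
  have gap: "0 \<le> f u - ?m" "f u - ?m \<le> \<epsilon>"
    using u opt_value_le[OF opt(1)] by (auto simp: sublevel_set_def)
  have "norm (u - w) \<le> \<sigma> * (f u - ?m) powr \<theta>"
    using leb u w(2) unfolding local_error_bound_def by (auto simp: dist_norm)
  also have "\<dots> \<le> \<sigma> * \<epsilon> powr \<theta>"
    using gap \<theta> \<sigma> by (intro mult_left_mono powr_mono2) auto
  finally have uw: "norm (u - w) \<le> \<sigma> * \<epsilon> powr \<theta>" .
  \<comment> \<open>Chosen so that the chord of \<open>f\<close> from \<open>w\<close> to
    \<open>x\<close> has height exactly \<open>\<epsilon>\<close> above the optimal value at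
    \<open>y\<close>.\<close>
  define \<tau> where "\<tau> = \<epsilon> / (f x - ?m)"
  have \<tau>: "0 < \<tau>" "\<tau> < 1" "\<tau> * (f x - ?m) = \<epsilon>"
    using False \<epsilon> by (auto simp: \<tau>_def)
  define y where "y = (1 - \<tau>) *\<^sub>R w + \<tau> *\<^sub>R x"
  have "y \<in> feasible_set c"
    unfolding y_def using w(1) x(1) \<tau>
    by (intro convexD[OF convex_feasible_set[OF c(1)]]) (auto simp: opt_set_def)
  moreover have "f y \<le> (1 - \<tau>) * f w + \<tau> * f x"
    unfolding y_def using \<tau> by (intro convex_onD[OF f(1)]) auto
  moreover have "(1 - \<tau>) * f w + \<tau> * f x = ?m + \<epsilon>"
    using \<tau>(3) opt_value_eq[OF w(1)] by (simp add: algebra_simps)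
  ultimately have "y \<in> ?S" by (simp add: sublevel_set_def)
  then have "(x - u) \<bullet> (y - u) \<le> 0"
    unfolding u_def by (rule closest_point_dot[OF S(2,1)])
  moreover have "y - u = \<tau> *\<^sub>R (x - u) - (1 - \<tau>) *\<^sub>R (u - w)"
    by (simp add: y_def algebra_simps)
  ultimately have "\<tau> * (norm (x - u))\<^sup>2 \<le> (1 - \<tau>) * ((x - u) \<bullet> (u - w))"
    by (simp add: inner_diff_right power2_norm_eq_inner)
  also have "\<dots> \<le> (1 - \<tau>) * (norm (x - u) * norm (u - w))"
    using \<tau> by (intro mult_left_mono norm_cauchy_schwarz) auto
  finally have "norm (x - u) * (\<tau> * norm (x - u)) \<le> norm (x - u) * ((1 - \<tau>) * norm (u - w))"
    by (simp add: power2_eq_square algebra_simps)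
  then have "\<tau> * norm (x - u) \<le> (1 - \<tau>) * norm (u - w)"
    using \<tau> by (cases "x = u") auto
  \<comment> \<open>Multiplying by the gap of \<open>x\<close> eliminates \<open>\<tau>\<close>: the
    weights become \<open>\<epsilon>\<close> and \<open>f x - ?m - \<epsilon>\<close>.\<close>
  then have "(f x - ?m) * (\<tau> * norm (x - u)) \<le> (f x - ?m) * ((1 - \<tau>) * norm (u - w))"
    using False \<epsilon> by (intro mult_left_mono) auto
  then have "\<epsilon> * norm (x - u) \<le> (f x - ?m - \<epsilon>) * norm (u - w)"
    using arg_cong[OF \<tau>(3), of "\<lambda>a. a * norm (x - u)"] arg_cong[OF \<tau>(3), of "\<lambda>a. a * norm (u - w)"]
    by (simp add: algebra_simps)
  also have "\<dots> \<le> \<delta> * (\<sigma> * \<epsilon> powr \<theta>)"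
    using x(2) uw \<delta> by (intro mult_mono) auto
  finally have "norm (x - u) \<le> \<delta> * (\<sigma> * \<epsilon> powr \<theta>) / \<epsilon>"
    using \<epsilon> by (simp add: field_simps)
  also have "\<dots> = \<sigma> * \<epsilon> powr (\<theta> - 1) * \<delta>"
    using \<epsilon> by (simp add: powr_diff)
  finally show thesis using that[OF u] by blast
qed

section \<open>Convergence of LoPGD by induction over the epochs\<close>

theorem theorem4:
  fixes f c :: "real ^ 'n \<Rightarrow> real"
    and x\<^sub>0 :: "real ^ 'n"
    and G G\<^sub>c \<rho> \<theta> \<sigma> \<epsilon> \<epsilon>\<^sub>0 lam p G' \<eta>\<^sub>1 :: real
    and K t :: nat
    and eta :: "nat \<Rightarrow> real"
    and z :: "nat \<Rightarrow> nat \<Rightarrow> real ^ 'n"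
    and xhat xs :: "nat \<Rightarrow> real ^ 'n"
  assumes "convex_on UNIV f"
    and "convex_on UNIV c" and "lower_semicontinuous c"
    and "\<rho> > 0" and "subgradient_lower_bound c \<rho> \<or> projection_error_bound c \<rho>"
    and "\<exists>x. c x < 0"
    and "G-lipschitz_on UNIV f" and "G\<^sub>c-lipschitz_on UNIV c"
    and "x\<^sub>0 \<in> feasible_set c" and "\<epsilon>\<^sub>0 \<ge> 0" and "f x\<^sub>0 - opt_value f c \<le> \<epsilon>\<^sub>0"
    and "opt_set f c \<noteq> {}" and "convex (opt_set f c)" and "compact (opt_set f c)"
    and "\<epsilon> > 0" and "0 < \<theta>" and "\<theta> \<le> 1" and "\<sigma> > 0" and "local_error_bound f c \<epsilon> \<theta> \<sigma>"
    and "lam > G / \<rho>"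
    and "p = lam * \<rho> / (lam * \<rho> - G)"
    and "G' = G + lam * G\<^sub>c"
    and "\<eta>\<^sub>1 = \<epsilon>\<^sub>0 / (2 * p * G'\<^sup>2)"
    and "int K = \<lceil>log 2 (\<epsilon>\<^sub>0 / \<epsilon>)\<rceil>" and "K \<ge> 1"
    and "int t = \<lceil>4 * \<sigma>\<^sup>2 * p\<^sup>2 * G'\<^sup>2 / \<epsilon> powr (2 * (1 - \<theta>))\<rceil>"
    and "LoPGD_run f c lam K t \<eta>\<^sub>1 x\<^sub>0 eta z xhat xs"
  shows "f (xs K) - opt_value f c \<le> 2 * \<epsilon>"
proof -
  have G0: "0 \<le> G" "0 \<le> G\<^sub>c" using assms(7,8) by (auto intro: lipschitz_on_nonneg)
  have lamr: "lam * \<rho> > G" using assms(4,20) by (simp add: divide_less_eq)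
  have lam0: "lam > 0" using assms(4,20) G0 by (meson divide_nonneg_pos le_less_trans)
  have p1: "p \<ge> 1" using lamr G0 unfolding assms(21) by simp
  have cont: "continuous_on UNIV f" "continuous_on UNIV c"
    using assms(7,8) by (auto intro: lipschitz_on_continuous_on)
  obtain y\<^sub>0 where y0: "c y\<^sub>0 < 0" using assms(6) by blast
  have peb: "projection_error_bound c \<rho>"
    using assms(5) projection_error_bound_if_subgradient_lower_bound[OF assms(2) cont(2) y0 assms(4)]
    by blast
  have F: "convex_on UNIV (penalized f c lam)" "G'-lipschitz_on UNIV (penalized f c lam)"
    using convex_on_penalized[OF assms(1,2)] lipschitz_on_penalized[OF assms(7,8)] lam0
    by (auto simp: assms(22))
  have feas: "closest_point (feasible_set c) x \<in> feasible_set c" for x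
    using assms(9) by (intro closest_point_in_set feasible_set_closed[OF cont(2)]) auto
  have Kpos: "0 < log 2 (\<epsilon>\<^sub>0 / \<epsilon>)" using assms(24,25) by linarith
  \<comment> \<open>By the convention \<open>ln 0 = 0\<close>, a vanishing
    \<open>\<epsilon>\<^sub>0\<close> would make the logarithm zero, against
    \<open>Kpos\<close>.\<close>
  then have e0: "\<epsilon>\<^sub>0 > 0" using assms(10,15) by (cases "\<epsilon>\<^sub>0 = 0") (auto simp: log_def)
  have "log 2 (\<epsilon>\<^sub>0 / \<epsilon>) \<le> real K" using assms(24) by linarith
  then have "\<epsilon>\<^sub>0 / \<epsilon> \<le> 2 ^ K"
    using e0 assms(15) by (simp add: log_le_iff powr_realpow)
  then have eK: "\<epsilon>\<^sub>0 / 2 ^ K \<le> \<epsilon>" using assms(15) by (simp add: field_simps)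
  have run: "xs 0 = x\<^sub>0" "eta 1 = \<eta>\<^sub>1"
    "\<And>k. k \<in> {1..K} \<Longrightarrow> z k 1 = xs (k - 1)"
    "\<And>k s. k \<in> {1..K} \<Longrightarrow> s \<in> {1..<t} \<Longrightarrow>
      \<exists>g\<in>subdifferential (penalized f c lam) (z k s). z k (s + 1) = z k s - eta k *\<^sub>R g"
    "\<And>k. k \<in> {1..K} \<Longrightarrow> xhat k = (1 / real t) *\<^sub>R (\<Sum>s=1..t. z k s)"
    "\<And>k. k \<in> {1..K} \<Longrightarrow> xs k = closest_point (feasible_set c) (xhat k)"
    "\<And>k. k \<in> {1..K} \<Longrightarrow> eta (k + 1) = eta k / 2"
    using assms(27) unfolding LoPGD_run_def by blast+
  have eta: "eta (k + 1) = \<eta>\<^sub>1 / 2 ^ k" if "k \<le> K" for k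
    using that
  proof (induction k)
    case (Suc k)
    then show ?case using run(7)[of "Suc k"] by simp
  qed (use run(2) in simp)
  show ?thesis
  proof (cases "G' = 0")
    case True
    \<comment> \<open>Here \<open>t = 0\<close> and \<open>\<eta>\<^sub>1\<close> is a division by zero, but \<open>f\<close> is constant.\<close>
    have "0 \<le> lam * G\<^sub>c" using lam0 G0 by simp
    then have "G = 0" using True G0 assms(22) by linarith
    then have const: "f x = f y" for x y using lipschitz_onD[OF assms(7), of x y] by simp
    obtain w where "w \<in> opt_set f c" using assms(12) by blast
    then have "opt_value f c = f (xs K)" using const opt_value_eq by metis
    then show ?thesis using assms(15) by simp
  next
    case False
    then have G': "G' > 0" using G0 lam0 assms(22) by (simp add: order_le_neq_trans)
    define T where "T = 4 * \<sigma>\<^sup>2 * p\<^sup>2 * G'\<^sup>2 / \<epsilon> powr (2 * (1 - \<theta>))"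
    \<comment> \<open>Positivity of \<open>T\<close> forces \<open>t \<ge> 1\<close>, so the average
      is over a nonempty set of iterates.\<close>
    have "T > 0" unfolding T_def using assms(15,18) p1 G' by simp
    then have t: "T \<le> real t" "t \<ge> 1" using assms(26) unfolding T_def[symmetric] by linarith+
    \<comment> \<open>The constant \<open>\<epsilon>\<close> is the allowed gap of the comparison
      point; only the second term halves. Feasibility is carried along because the distance lemma
      requires it.\<close>
    have "xs k \<in> feasible_set c \<and> f (xs k) - opt_value f c \<le> \<epsilon> + \<epsilon>\<^sub>0 / 2 ^ k" if "k \<le> K" for k
      using that
    proof (induction k)
      case 0
      then show ?case using run(1) assms(9,11,15) by simp
    next
      case (Suc k)
      then have IH: "xs k \<in> feasible_set c" "f (xs k) - opt_value f c \<le> \<epsilon> + \<epsilon>\<^sub>0 / 2 ^ k"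
        and mem: "Suc k \<in> {1..K}" by auto
      let ?\<delta> = "\<epsilon>\<^sub>0 / 2 ^ k" and ?\<eta> = "eta (Suc k)"
      have \<delta>: "?\<delta> > 0" using e0 by simp
      obtain u where u: "u \<in> sublevel_set f c \<epsilon>"
          "norm (xs k - u) \<le> \<sigma> * \<epsilon> powr (\<theta> - 1) * ?\<delta>"
        using distance_to_sublevel_set[OF assms(1) cont(1) assms(2) cont(2) assms(12,14,15) _ _
            assms(19) IH] assms(16,18) \<delta> by (metis less_imp_le)
      \<comment> \<open>Epoch \<open>Suc k\<close> has seen \<open>k\<close> halvings, so its step
        is proportional to \<open>?\<delta>\<close>, the excess allowed at its start.\<close>
      have \<eta>_eq: "?\<eta> = ?\<delta> / (2 * p * G'\<^sup>2)"
        using eta[of k] Suc.prems by (simp add: assms(23) field_simps)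
      then have \<eta>: "?\<eta> > 0" using e0 p1 G' by (auto intro!: divide_pos_pos)
      have "(norm (xs k - u))\<^sup>2 \<le> (\<sigma> * \<epsilon> powr (\<theta> - 1) * ?\<delta>)\<^sup>2"
        using u(2) by (intro power_mono) auto
      also have "\<dots> = \<sigma>\<^sup>2 / \<epsilon> powr (2 * (1 - \<theta>)) * ?\<delta>\<^sup>2"
      proof -
        have "(\<epsilon> powr (\<theta> - 1))\<^sup>2 = \<epsilon> powr (- (2 * (1 - \<theta>)))"
          using assms(15) by (simp add: power2_eq_square powr_add[symmetric])
        also have "\<dots> = 1 / \<epsilon> powr (2 * (1 - \<theta>))" by (rule powr_minus_divide)
        finally show ?thesis unfolding power_mult_distrib by simp
      qed
      \<comment> \<open>The choice of \<open>t\<close> is made for this: the factor from the error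
        bound is \<open>T\<close> up to \<open>4 * p\<^sup>2 * G'\<^sup>2\<close>.\<close>
      also have "\<dots> = T * ?\<delta>\<^sup>2 / (4 * p\<^sup>2 * G'\<^sup>2)"
        unfolding T_def using p1 G' by simp
      also have "\<dots> \<le> real t * ?\<delta>\<^sup>2 / (4 * p\<^sup>2 * G'\<^sup>2)"
        using t(1) by (intro divide_right_mono mult_right_mono) auto
      finally have D: "(norm (xs k - u))\<^sup>2 \<le> \<dots>" .
      have "f (xs (Suc k)) \<le> penalized f c lam (xhat (Suc k))"
        unfolding run(6)[OF mem]
        using objective_at_projection_le_penalized[OF assms(7) peb assms(4)] lamr by simp
      moreover have "penalized f c lam (xhat (Suc k)) - penalized f c lam u
          \<le> (norm (z (Suc k) 1 - u))\<^sup>2 / (2 * ?\<eta> * real t) + ?\<eta> * G'\<^sup>2 / 2"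
        unfolding run(5)[OF mem] 
        using run(4)[OF mem] by (intro averaged_subgradient_method[OF F \<eta> t(2)])
      \<comment> \<open>The penalty vanishes at the feasible point \<open>u\<close>.\<close>
      moreover have "penalized f c lam u \<le> opt_value f c + \<epsilon>"
        using u(1) by (simp add: penalized_def sublevel_set_def feasible_set_def)
      \<comment> \<open>The distance term and the step-size term are each at most
        \<open>?\<delta> / (4 * p)\<close>, hence at most \<open>?\<delta> / 4\<close> by
        \<open>p1\<close>; together they give the halved excess.\<close>
      moreover have "(norm (z (Suc k) 1 - u))\<^sup>2 / (2 * ?\<eta> * real t) \<le> ?\<delta> / 4"
      proof -
        have "(norm (z (Suc k) 1 - u))\<^sup>2 / (2 * ?\<eta> * real t)
            \<le> real t * ?\<delta>\<^sup>2 / (4 * p\<^sup>2 * G'\<^sup>2) / (2 * ?\<eta> * real t)"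
          using D \<eta> run(3)[OF mem] by (intro divide_right_mono) auto
        also have "\<dots> = ?\<delta> / (4 * p)"
          unfolding \<eta>_eq using t(2) p1 G' e0 by (simp add: power2_eq_square)
        also have "\<dots> \<le> ?\<delta> / 4" using p1 \<delta> by (intro divide_left_mono) auto
        finally show ?thesis .
      qed
      moreover have "?\<eta> * G'\<^sup>2 / 2 \<le> ?\<delta> / 4"
      proof -
        have "?\<eta> * G'\<^sup>2 / 2 = ?\<delta> / (4 * p)" unfolding \<eta>_eq using G' by simp
        also have "\<dots> \<le> ?\<delta> / 4" using p1 \<delta> by (intro divide_left_mono) auto
        finally show ?thesis .
      qed
      moreover have "\<epsilon>\<^sub>0 / 2 ^ Suc k = ?\<delta> / 2" by simp
      ultimately have "f (xs (Suc k)) - opt_value f c \<le> \<epsilon> + \<epsilon>\<^sub>0 / 2 ^ Suc k" by linarith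
      then show ?case using feas run(6)[OF mem] by simp
    qed
    \<comment> \<open>After \<open>K\<close> halvings the second term is at most
      \<open>\<epsilon>\<close> by \<open>eK\<close>, which gives the factor 2.\<close>
    from this[of K] show ?thesis using eK by simp
  qed
qed

end
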